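(* Let $\operatorname{P}=\operatorname{P}_\theta\in \operatorname{MM}(A,S)$ with parameter vector $\theta=(\theta_F,\theta_V,\theta_{C\setminus V})$, and let $\tilde{\operatorname{P}}=\operatorname{P}_{\tilde\theta}$ be the $\tilde\theta_V$-proportional covariation of $\operatorname{P}$, with parameter vector $\tilde\theta=(\theta_F,\tilde\theta_V,\tilde\theta_{C\setminus V})$. Let $L_{\mathrm{constr}}$ be the set of all $\operatorname{Q}\in L_{\mathrm{sensi}}$, with parameter vector $\bar\theta=(\theta_F,\tilde\theta_V,\bar\theta_{C\setminus V})$, such that $$\sum_{H\subseteq C,\,H\neq \emptyset}\tilde\theta_{V\cap H}\left(\bar\theta_{(C\setminus V)\cap H}-\tilde\theta_{(C\setminus V)\cap H}\right)\ln\left(\alpha_H\frac{\tilde\theta_{V\cap H}}{\theta_{V\cap H}}\right)\sum_{y\in\mathbb{Y}_H}\theta_{F}^{A_{y,F}}\ge 0,$$ where $$\alpha_H=\prod_{i\in[n]:\,S_i\cap H\neq\emptyset}\ \prod_{j\in (S_i\setminus V)\cap H}\frac{1-|\tilde\theta_{V_i}|}{1-|\theta_{V_i}|}.$$ Then $\tilde{\operatorname{P}}$ is the I-projection of $\operatorname{P}$ in $L_{\mathrm{constr}}$, i.e. $\tilde{\operatorname{P}}\in L_{\mathrm{constr}}$ and $\mathcal D(\tilde{\operatorname{P}}\|\operatorname{P})=\min_{\operatorname{Q}\in L_{\mathrm{constr}}}\mathcal D(\operatorname{Q}\|\operatorname{P})$.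
   Context: Notation: $[k]=\{1,\dots,k\}$; $|v|$ is the sum of the entries of a vector $v$; for a finite index set $S$, $\theta_S=(\theta_i)_{i\in S}$; $\Delta_{m-1}$ denotes the set of vectors of length $m$ with strictly positive entries summing to one. Monomial model. $\mathbb Y$ is a finite set with $q$ elements, $A$ is a $q\times k$ matrix of non-negative integers with rows $A_y$, $y\in\mathbb Y$ (no row has all entries equal to $0$ or all entries equal to $1$), and $S=\{S_1,\dots,S_n\}$ is a partition of $[k]$. The parameter space is $\Theta=\prod_{i\in[n]}\Delta_{\#S_i-1}$, i.e. the $\theta\in\mathbb R_{>0}^k$ with $|\theta_{S_i}|=1$ for every $i\in[n]$. For $\theta\in\Theta$ set $\operatorname{P}_\theta(y)=\theta^{A_y}=\prod_{i\in[k]}\theta_i^{A_{y,i}}$. It is assumed that $\sum_{y\in\mathbb Y}\operatorname{P}_\theta(y)=1$ for every $\theta\in\Theta$. The monomial model is $\operatorname{MM}(A,S)=\{\operatorname{P}_\theta:\theta\in\Theta\}$. The model is assumed multilinear ($A$ has entries in $\{0,1\}$) and regular (for all $y\in\mathbb Y$ and $i\in[n]$, $A_{y,j}=1$ for at most one $j\in S_i$). For $B\subseteq[k]$, $\theta_B^{A_{y,B}}=\prod_{i\in B}\theta_i^{A_{y,i}}$. Varied, covaried and fixed parameters. Let $\emptyset\ne V\subset[k]$ and $V_i=V\cap S_i$, with $V_i\subsetneq S_i$ for each $i$. Let $C=\bigcup_{i\in[n]:V_i\neq\emptyset}S_i$ and $F=[k]\setminus C$. Let $\tilde\theta_V$ be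 a vector of positive numbers with $|\tilde\theta_{V_i}|\in(0,1)$ whenever $V_i\neq\emptyset$. Proportional covariation. The $\tilde\theta_V$-proportional covariation of $\operatorname{P}_\theta$ is $\operatorname{P}_{\tilde\theta}$, where on each block $S_i$: if $V_i=\emptyset$ then $\tilde\theta_{S_i}=\theta_{S_i}$; if $V_i\ne\emptyset$ then the entries indexed by $V_i$ are set to $\tilde\theta_{V_i}$ and $\tilde\theta_j=\frac{1-|\tilde\theta_{V_i}|}{1-|\theta_{V_i}|}\theta_j$ for $j\in S_i\setminus V_i$. $L_{\mathrm{sensi}}$ is the set of all densities $\operatorname{P}_{\bar\theta}\in\operatorname{MM}(A,S)$ whose parameter vector satisfies $\bar\theta_F=\theta_F$ and $\bar\theta_V=\tilde\theta_V$ (only the parameters indexed by $C\setminus V$ are free). For $\emptyset\neq H\subseteq C$, $\mathbb{Y}_H=\{y\in\mathbb{Y}: A_{y,i}=1 \text{ for all } i\in H \text{ and } A_{y,i}=0 \text{ for all } i\in C\setminus H\}$; only $H$ with $\mathbb Y_H\neq\emptyset$ contribute to the sum. In the displayed condition, for $B\subseteq[k]$, $\theta_B$ denotes the monomial $\prod_{i\in B}\theta_i$ (equal to $1$ for $B=\emptyset$), and likewise for $\tilde\theta_B$, $\bar\theta_B$; in contrast $|\theta_{V_i}|$ is the sum of the entries of the vector $\theta_{V_i}$. The I-divergence (Kullback-Leibler divergence) is $\mathcal D(\operatorname{Q}\|\operatorname{P})=\sum_{y\in\mathbb Y}\operatorname{Q}(y)\ln\frac{\operatorname{Q}(y)}{\operatorname{P}(y)}$.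 An I-projection of $\operatorname{P}$ onto a set $L$ of distributions is an element $\operatorname{P}^*\in L$ with $\mathcal D(\operatorname{P}^*\|\operatorname{P})=\min_{\operatorname{Q}\in L}\mathcal D(\operatorname{Q}\|\operatorname{P})$. *)

theory Defs
  imports Complex_Main "HOL-Library.FuncSet" "HOL-Library.Disjoint_Sets"
begin

(* Vectors of length k are functions nat => real of which only the values on {1..k} matter.
   Distributions on the finite set Y are functions that are undefined outside Y, so that equality
   of distributions is equality on Y. *)

definition param_space :: "nat \<Rightarrow> nat \<Rightarrow> (nat \<Rightarrow> nat set) \<Rightarrow> (nat \<Rightarrow> real) set" where
  "param_space k n S =
     {\<theta>. (\<forall>j\<in>{1..k}. \<theta> j > 0) \<and> (\<forall>i\<in>{1..n}. (\<Sum>j\<in>S i. \<theta> j) = 1)}"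

definition mono_pow :: "nat set \<Rightarrow> (nat \<Rightarrow> real) \<Rightarrow> (nat \<Rightarrow> nat) \<Rightarrow> real" where
  "mono_pow B \<theta> a = (\<Prod>i\<in>B. \<theta> i ^ a i)"

definition mono_density ::
  "'y set \<Rightarrow> nat \<Rightarrow> ('y \<Rightarrow> nat \<Rightarrow> nat) \<Rightarrow> (nat \<Rightarrow> real) \<Rightarrow> 'y \<Rightarrow> real" where
  "mono_density Y k A \<theta> = (\<lambda>y\<in>Y. mono_pow {1..k} \<theta> (A y))"

definition monomial_model ::
  "'y set \<Rightarrow> nat \<Rightarrow> ('y \<Rightarrow> nat \<Rightarrow> nat) \<Rightarrow> nat \<Rightarrow> (nat \<Rightarrow> nat set) \<Rightarrow> bool" where
  "monomial_model Y k A n S \<longleftrightarrow>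
     finite Y \<and>
     (\<forall>y\<in>Y. (\<exists>j\<in>{1..k}. A y j \<noteq> 0) \<and> (\<exists>j\<in>{1..k}. A y j \<noteq> 1)) \<and>
     inj_on S {1..n} \<and> partition_on {1..k} (S ` {1..n}) \<and>
     (\<forall>\<theta>\<in>param_space k n S. (\<Sum>y\<in>Y. mono_density Y k A \<theta> y) = 1)"

definition multilinear_model :: "'y set \<Rightarrow> nat \<Rightarrow> ('y \<Rightarrow> nat \<Rightarrow> nat) \<Rightarrow> bool" where
  "multilinear_model Y k A \<longleftrightarrow> (\<forall>y\<in>Y. \<forall>j\<in>{1..k}. A y j \<in> {0, 1})"

definition regular_model ::
  "'y set \<Rightarrow> ('y \<Rightarrow> nat \<Rightarrow> nat) \<Rightarrow> nat \<Rightarrow> (nat \<Rightarrow> nat set) \<Rightarrow> bool" where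
  "regular_model Y A n S \<longleftrightarrow> (\<forall>y\<in>Y. \<forall>i\<in>{1..n}. \<exists>\<^sub>\<le>\<^sub>1 j. j \<in> S i \<and> A y j = 1)"

definition MM ::
  "'y set \<Rightarrow> nat \<Rightarrow> ('y \<Rightarrow> nat \<Rightarrow> nat) \<Rightarrow> nat \<Rightarrow> (nat \<Rightarrow> nat set) \<Rightarrow> ('y \<Rightarrow> real) set" where
  "MM Y k A n S = mono_density Y k A ` param_space k n S"

definition covar_set :: "nat \<Rightarrow> (nat \<Rightarrow> nat set) \<Rightarrow> nat set \<Rightarrow> nat set" where
  "covar_set n S V = (\<Union>i\<in>{i\<in>{1..n}. V \<inter> S i \<noteq> {}}. S i)"

definition fixed_set :: "nat \<Rightarrow> nat \<Rightarrow> (nat \<Rightarrow> nat set) \<Rightarrow> nat set \<Rightarrow> nat set" where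
  "fixed_set k n S V = {1..k} - covar_set n S V"

definition block_index :: "nat \<Rightarrow> (nat \<Rightarrow> nat set) \<Rightarrow> nat \<Rightarrow> nat" where
  "block_index n S j = (THE i. i \<in> {1..n} \<and> j \<in> S i)"

definition covar_ratio ::
  "(nat \<Rightarrow> nat set) \<Rightarrow> nat set \<Rightarrow> (nat \<Rightarrow> real) \<Rightarrow> (nat \<Rightarrow> real) \<Rightarrow> nat \<Rightarrow> real" where
  "covar_ratio S V \<theta> t i = (1 - (\<Sum>j\<in>V \<inter> S i. t j)) / (1 - (\<Sum>j\<in>V \<inter> S i. \<theta> j))"

(* Only the values of t on V enter. *)
definition prop_covar ::
  "nat \<Rightarrow> (nat \<Rightarrow> nat set) \<Rightarrow> nat set \<Rightarrow> (nat \<Rightarrow> real) \<Rightarrow> (nat \<Rightarrow> real) \<Rightarrow> nat \<Rightarrow> real" where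
  "prop_covar n S V \<theta> t j =
     (let i = block_index n S j in
      if V \<inter> S i = {} then \<theta> j
      else if j \<in> V then t j
      else covar_ratio S V \<theta> t i * \<theta> j)"

lemma prop_covar_on_block:
  assumes "inj_on S {1..n}" "partition_on {1..k} (S ` {1..n})" "i \<in> {1..n}" "j \<in> S i"
  shows "prop_covar n S V \<theta> t j =
     (if V \<inter> S i = {} then \<theta> j else if j \<in> V \<inter> S i then t j
      else (1 - (\<Sum>l\<in>V \<inter> S i. t l)) / (1 - (\<Sum>l\<in>V \<inter> S i. \<theta> l)) * \<theta> j)"
proof -
  have "i' = i" if "i' \<in> {1..n}" "j \<in> S i'" for i'
  proof -
    have "S i' = S i"
      using assms(2-4) that unfolding partition_on_def disjoint_def by blast
    then show ?thesis
      using assms(1,3) that(1) by (auto dest: inj_onD)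
  qed
  then have "block_index n S j = i"
    unfolding block_index_def using assms(3,4) by blast
  then show ?thesis
    using assms(4) by (simp add: prop_covar_def covar_ratio_def)
qed

definition sensi_params ::
  "nat \<Rightarrow> nat \<Rightarrow> (nat \<Rightarrow> nat set) \<Rightarrow> nat set \<Rightarrow> (nat \<Rightarrow> real) \<Rightarrow> (nat \<Rightarrow> real) \<Rightarrow> (nat \<Rightarrow> real) set" where
  "sensi_params k n S V \<theta> t =
     {\<beta> \<in> param_space k n S. (\<forall>j\<in>fixed_set k n S V. \<beta> j = \<theta> j) \<and> (\<forall>j\<in>V. \<beta> j = t j)}"

definition L_sensi ::
  "'y set \<Rightarrow> nat \<Rightarrow> ('y \<Rightarrow> nat \<Rightarrow> nat) \<Rightarrow> nat \<Rightarrow> (nat \<Rightarrow> nat set) \<Rightarrow> nat set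
     \<Rightarrow> (nat \<Rightarrow> real) \<Rightarrow> (nat \<Rightarrow> real) \<Rightarrow> ('y \<Rightarrow> real) set" where
  "L_sensi Y k A n S V \<theta> t =
     {Q \<in> MM Y k A n S. \<exists>\<beta>\<in>sensi_params k n S V \<theta> t. Q = mono_density Y k A \<beta>}"

definition Y_pattern ::
  "'y set \<Rightarrow> ('y \<Rightarrow> nat \<Rightarrow> nat) \<Rightarrow> nat set \<Rightarrow> nat set \<Rightarrow> 'y set" where
  "Y_pattern Y A C H = {y \<in> Y. (\<forall>i\<in>H. A y i = 1) \<and> (\<forall>i\<in>C - H. A y i = 0)}"

definition alpha ::
  "nat \<Rightarrow> (nat \<Rightarrow> nat set) \<Rightarrow> nat set \<Rightarrow> (nat \<Rightarrow> real) \<Rightarrow> (nat \<Rightarrow> real) \<Rightarrow> nat set \<Rightarrow> real" where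
  "alpha n S V \<theta> t H =
     (\<Prod>i\<in>{i\<in>{1..n}. S i \<inter> H \<noteq> {}}. \<Prod>j\<in>(S i - V) \<inter> H. covar_ratio S V \<theta> t i)"

(* Subsets H with no matching y contribute 0, because the inner sum over y is then empty. *)
definition constr_sum ::
  "'y set \<Rightarrow> nat \<Rightarrow> ('y \<Rightarrow> nat \<Rightarrow> nat) \<Rightarrow> nat \<Rightarrow> (nat \<Rightarrow> nat set) \<Rightarrow> nat set
     \<Rightarrow> (nat \<Rightarrow> real) \<Rightarrow> (nat \<Rightarrow> real) \<Rightarrow> (nat \<Rightarrow> real) \<Rightarrow> real" where
  "constr_sum Y k A n S V \<theta> t \<beta> =
     (let C = covar_set n S V; F = fixed_set k n S V; \<tau> = prop_covar n S V \<theta> t in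
      \<Sum>H\<in>{H. H \<subseteq> C \<and> H \<noteq> {}}.
        prod \<tau> (V \<inter> H) * (prod \<beta> ((C - V) \<inter> H) - prod \<tau> ((C - V) \<inter> H))
        * ln (alpha n S V \<theta> t H * (prod \<tau> (V \<inter> H) / prod \<theta> (V \<inter> H)))
        * (\<Sum>y\<in>Y_pattern Y A C H. mono_pow F \<theta> (A y)))"

definition L_constr ::
  "'y set \<Rightarrow> nat \<Rightarrow> ('y \<Rightarrow> nat \<Rightarrow> nat) \<Rightarrow> nat \<Rightarrow> (nat \<Rightarrow> nat set) \<Rightarrow> nat set
     \<Rightarrow> (nat \<Rightarrow> real) \<Rightarrow> (nat \<Rightarrow> real) \<Rightarrow> ('y \<Rightarrow> real) set" where
  "L_constr Y k A n S V \<theta> t =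
     {Q \<in> L_sensi Y k A n S V \<theta> t.
        \<exists>\<beta>\<in>sensi_params k n S V \<theta> t.
          Q = mono_density Y k A \<beta> \<and> constr_sum Y k A n S V \<theta> t \<beta> \<ge> 0}"

definition I_divergence :: "'y set \<Rightarrow> ('y \<Rightarrow> real) \<Rightarrow> ('y \<Rightarrow> real) \<Rightarrow> real" where
  "I_divergence Y Q P = (\<Sum>y\<in>Y. Q y * ln (Q y / P y))"

definition is_I_projection ::
  "'y set \<Rightarrow> ('y \<Rightarrow> real) \<Rightarrow> ('y \<Rightarrow> real) set \<Rightarrow> ('y \<Rightarrow> real) \<Rightarrow> bool" where
  "is_I_projection Y P L R \<longleftrightarrow>
     R \<in> L \<and> (\<forall>Q\<in>L. I_divergence Y R P \<le> I_divergence Y Q P)"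

end

theory Submission imports Defs begin

text \<open>
  Write P~ for the proportional covariation of P and Q for a competitor in the constrained set. Then
  D(Q || P) - D(P~ || P) = D(Q || P~) + (\<Sum>y. (Q y - P~ y) * ln (P~ y / P y)). The first summand
  is non-negative by Gibbs' inequality. Grouping the outcomes y by the set H of indices
  in C on which A y equals 1 shows that the second one is exactly the constraint functional,
  because ln (P~ y / P y) depends on y only through H.
\<close>

section \<open>Gibbs' inequality and differences of divergences\<close>

lemma I_divergence_nonneg:
  assumes "finite Y" "\<forall>y\<in>Y. Q y > 0" "\<forall>y\<in>Y. P y > 0" "(\<Sum>y\<in>Y. Q y) = (\<Sum>y\<in>Y. P y)"
  shows "I_divergence Y Q P \<ge> 0"
proof -
  \<comment> \<open>The tangent bound ln x \<le> x - 1 at x = P y / Q y, multiplied by Q y. Summed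
    over Y, the left-hand sides vanish because the total masses agree.\<close>
  have "Q y - P y \<le> Q y * ln (Q y / P y)" if y: "y \<in> Y" for y
  proof -
    have pos: "Q y > 0" "P y > 0" using assms y by auto
    have "ln (P y / Q y) \<le> P y / Q y - 1" using pos by (intro ln_le_minus_one) simp
    then have "Q y * ln (P y / Q y) \<le> Q y * (P y / Q y - 1)"
      using pos by (intro mult_left_mono) auto
    moreover have "Q y * (P y / Q y - 1) = P y - Q y" using pos by (simp add: field_simps)
    moreover have "ln (P y / Q y) = - ln (Q y / P y)" using pos by (simp add: ln_div)
    ultimately show ?thesis by simp
  qed
  then have "(\<Sum>y\<in>Y. Q y - P y) \<le> I_divergence Y Q P"
    unfolding I_divergence_def by (rule sum_mono)
  then show ?thesis using assms(4) by (simp add: sum_subtractf)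
qed

text \<open>The identity already holds outcome by outcome: split ln (Q y / P y) as ln (Q y / R y) +
  ln (R y / P y).\<close>

lemma I_divergence_diff:
  assumes "\<forall>y\<in>Y. Q y > 0" "\<forall>y\<in>Y. R y > 0" "\<forall>y\<in>Y. P y > 0"
  shows "I_divergence Y Q P - I_divergence Y R P =
    I_divergence Y Q R + (\<Sum>y\<in>Y. (Q y - R y) * ln (R y / P y))"
  unfolding I_divergence_def sum_subtractf[symmetric] sum.distrib[symmetric]
proof (rule sum.cong[OF refl])
  fix y assume "y \<in> Y"
  then have "Q y > 0" "R y > 0" "P y > 0" using assms by auto
  then show "Q y * ln (Q y / P y) - R y * ln (R y / P y) =
      Q y * ln (Q y / R y) + (Q y - R y) * ln (R y / P y)"
    by (simp add: ln_div algebra_simps)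
qed

lemma mono_pow_pos:
  assumes "\<forall>j\<in>B. \<theta> j > 0"
  shows "mono_pow B \<theta> a > 0"
  unfolding mono_pow_def using assms by (intro prod_pos) auto

lemma mono_pow_indicator:
  assumes "finite B" "H \<subseteq> B" "\<forall>i\<in>H. a i = 1" "\<forall>i\<in>B - H. a i = 0"
  shows "mono_pow B \<theta> a = prod \<theta> H"
  unfolding mono_pow_def using assms
  by (intro prod.mono_neutral_cong_right) auto

section \<open>The covariation setting and its block structure\<close>

locale covariation =
  fixes Y :: "'y set" and k n :: nat and A :: "'y \<Rightarrow> nat \<Rightarrow> nat"
    and S :: "nat \<Rightarrow> nat set" and V :: "nat set" and \<theta> t :: "nat \<Rightarrow> real"
  assumes model: "monomial_model Y k A n S"
    and multilinear: "multilinear_model Y k A"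
    and \<theta>: "\<theta> \<in> param_space k n S"
    and V_sub: "V \<subseteq> {1..k}"
    and V_proper: "\<forall>i\<in>{1..n}. V \<inter> S i \<subset> S i"
    and t_pos: "\<forall>j\<in>V. t j > 0"
    and t_sum: "\<forall>i\<in>{1..n}. V \<inter> S i \<noteq> {} \<longrightarrow> (\<Sum>j\<in>V \<inter> S i. t j) \<in> {0<..<1}"
begin

abbreviation "C \<equiv> covar_set n S V"
abbreviation "F \<equiv> fixed_set k n S V"
abbreviation "\<tau> \<equiv> prop_covar n S V \<theta> t"

lemma finite_Y: "finite Y"
  using model by (simp add: monomial_model_def)

lemma inj_S: "inj_on S {1..n}" and part_S: "partition_on {1..k} (S ` {1..n})"
  using model by (simp_all add: monomial_model_def)

lemma S_sub: "i \<in> {1..n} \<Longrightarrow> S i \<subseteq> {1..k}"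
  using part_S unfolding partition_on_def by blast

lemma finite_S: "i \<in> {1..n} \<Longrightarrow> finite (S i)"
  using S_sub finite_subset by blast

lemma block_exists: "j \<in> {1..k} \<Longrightarrow> \<exists>i\<in>{1..n}. j \<in> S i"
  using part_S unfolding partition_on_def by blast

lemma block_unique:
  assumes "i \<in> {1..n}" "i' \<in> {1..n}" "j \<in> S i" "j \<in> S i'"
  shows "i = i'"
proof -
  have "S i = S i'"
    using part_S assms unfolding partition_on_def disjoint_def by blast
  then show ?thesis using inj_S assms by (auto dest: inj_onD)
qed

lemma C_sub: "C \<subseteq> {1..k}"
  unfolding covar_set_def using S_sub by blast

lemma V_sub_C: "V \<subseteq> C"
proof
  fix j assume "j \<in> V"
  moreover from this obtain i where "i \<in> {1..n}" "j \<in> S i"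
    using V_sub block_exists by blast
  ultimately show "j \<in> C" unfolding covar_set_def by blast
qed

lemma finite_C: "finite C"
  using C_sub finite_subset by blast

text \<open>C is a union of whole blocks, each meeting V. By disjointness, the only block containing
  j is one of these.\<close>

lemma covar_block_meets_V:
  assumes "i \<in> {1..n}" "j \<in> S i" "j \<in> C"
  shows "V \<inter> S i \<noteq> {}"
  using assms block_unique[of i _ j] unfolding covar_set_def by blast

text \<open>With the block of j named explicitly, later arguments avoid the definite description in
  \<open>block_index\<close>.\<close>

lemmas \<tau>_on_block = prop_covar_on_block[OF inj_S part_S, of _ _ V \<theta> t]

section \<open>The proportional covariation as a parameter vector\<close>

lemma \<theta>_pos: "j \<in> {1..k} \<Longrightarrow> \<theta> j > 0"
  using \<theta> by (simp add: param_space_def)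

text \<open>V misses some index of every block, and that index carries positive weight. Hence the
  denominator of \<open>covar_ratio\<close> is positive.\<close>

lemma \<theta>_V_less_1:
  assumes i: "i \<in> {1..n}"
  shows "(\<Sum>j\<in>V \<inter> S i. \<theta> j) < 1"
proof -
  have "(\<Sum>j\<in>V \<inter> S i. \<theta> j) < (\<Sum>j\<in>S i. \<theta> j)"
  proof -
    obtain b where "b \<in> S i - V \<inter> S i" using V_proper i by blast
    moreover have "\<theta> j > 0" if "j \<in> S i" for j
      using S_sub[OF i] \<theta>_pos that by blast
    ultimately show ?thesis
      using finite_S[OF i] by (intro sum_strict_mono2[of "S i" _ b]) (auto intro: less_imp_le)
  qed
  then show ?thesis using \<theta> i by (simp add: param_space_def)
qed

lemma covar_ratio_pos:
  assumes "i \<in> {1..n}" "V \<inter> S i \<noteq> {}"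
  shows "covar_ratio S V \<theta> t i > 0"
  using \<theta>_V_less_1[of i] t_sum assms unfolding covar_ratio_def by auto

lemma \<tau>_pos:
  assumes j: "j \<in> {1..k}"
  shows "\<tau> j > 0"
proof -
  obtain i where "i \<in> {1..n}" "j \<in> S i" using block_exists[OF j] by blast
  then show ?thesis
    using \<tau>_on_block[of i j] t_pos mult_pos_pos[OF covar_ratio_pos[of i] \<theta>_pos[OF j]] \<theta>_pos[OF j]
    by (auto simp: covar_ratio_def)
qed

lemma \<tau>_sum:
  assumes i: "i \<in> {1..n}"
  shows "(\<Sum>j\<in>S i. \<tau> j) = 1"
proof (cases "V \<inter> S i = {}")
  case True
  then have "(\<Sum>j\<in>S i. \<tau> j) = (\<Sum>j\<in>S i. \<theta> j)"
    using \<tau>_on_block[OF i] by (intro sum.cong) auto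
  then show ?thesis using \<theta> i by (simp add: param_space_def)
next
  case False
  let ?s = "\<Sum>j\<in>V \<inter> S i. \<theta> j" and ?r = "covar_ratio S V \<theta> t i"
  have split: "sum f (S i) = sum f (S i - V \<inter> S i) + sum f (V \<inter> S i)" for f :: "nat \<Rightarrow> real"
    using finite_S[OF i] by (intro sum.subset_diff) auto
  have "(\<Sum>j\<in>S i. \<theta> j) = 1" using \<theta> i by (simp add: param_space_def)
  then have rest: "(\<Sum>j\<in>S i - V \<inter> S i. \<theta> j) = 1 - ?s" using split[of \<theta>] by simp
  have "(\<Sum>j\<in>S i - V \<inter> S i. \<tau> j) = (\<Sum>j\<in>S i - V \<inter> S i. ?r * \<theta> j)"
    using \<tau>_on_block[OF i] False by (intro sum.cong) (auto simp: covar_ratio_def)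
  \<comment> \<open>The ratio is designed for this cancellation: it rescales the mass 1 -
    \<open>?s\<close> outside V to exactly the mass that the new values on V leave over.\<close>
  also have "\<dots> = ?r * (1 - ?s)"
    by (simp only: rest sum_distrib_left[symmetric])
  also have "\<dots> = 1 - (\<Sum>j\<in>V \<inter> S i. t j)"
    using \<theta>_V_less_1[OF i] by (simp add: covar_ratio_def)
  finally have "(\<Sum>j\<in>S i - V \<inter> S i. \<tau> j) = 1 - (\<Sum>j\<in>V \<inter> S i. t j)" .
  moreover have "(\<Sum>j\<in>V \<inter> S i. \<tau> j) = (\<Sum>j\<in>V \<inter> S i. t j)"
    using \<tau>_on_block[OF i] by (intro sum.cong) auto
  ultimately show ?thesis using split[of \<tau>] by simp
qed

lemma \<tau>_param: "\<tau> \<in> param_space k n S"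
  unfolding param_space_def using \<tau>_pos \<tau>_sum by auto

text \<open>Besides giving membership in \<open>L_sensi\<close>, this supplies the agreement with
  \<theta> on F that lets the F-factor be shared by all densities compared below.\<close>

lemma \<tau>_sensi: "\<tau> \<in> sensi_params k n S V \<theta> t"
proof -
  have "\<tau> j = \<theta> j" if "j \<in> F" for j
  proof -
    have "j \<in> {1..k}" "j \<notin> C" using that by (auto simp: fixed_set_def)
    then obtain i where i: "i \<in> {1..n}" "j \<in> S i" using block_exists by blast
    then have "V \<inter> S i = {}" using \<open>j \<notin> C\<close> unfolding covar_set_def by blast
    then show ?thesis using \<tau>_on_block[OF i] by simp
  qed
  moreover have "\<tau> j = t j" if "j \<in> V" for j
  proof -
    obtain i where i: "i \<in> {1..n}" "j \<in> S i" using V_sub block_exists \<open>j \<in> V\<close> by blast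
    then show ?thesis using \<tau>_on_block[OF i] \<open>j \<in> V\<close> by auto
  qed
  ultimately show ?thesis unfolding sensi_params_def using \<tau>_param by auto
qed

section \<open>Densities on outcomes with a given pattern on C\<close>

lemma density_pos:
  assumes "\<beta> \<in> param_space k n S" "y \<in> Y"
  shows "mono_density Y k A \<beta> y > 0"
  using assms mono_pow_pos[of "{1..k}" \<beta>] by (simp add: mono_density_def param_space_def)

lemma density_sum:
  assumes "\<beta> \<in> param_space k n S"
  shows "(\<Sum>y\<in>Y. mono_density Y k A \<beta> y) = 1"
  using assms model by (simp add: monomial_model_def)

text \<open>On the outcomes with pattern H the exponents on C are the indicator of H, so the C-part
  of the monomial collapses to a product over H, which V splits in two.\<close>

lemma density_on_pattern:
  assumes y: "y \<in> Y_pattern Y A C H" and H: "H \<subseteq> C" and eq: "\<forall>j\<in>F. \<beta> j = \<theta> j"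
  shows "mono_density Y k A \<beta> y = prod \<beta> (V \<inter> H) * prod \<beta> ((C - V) \<inter> H) * mono_pow F \<theta> (A y)"
proof -
  have "mono_density Y k A \<beta> y = mono_pow {1..k} \<beta> (A y)"
    using y by (simp add: mono_density_def Y_pattern_def)
  also have "\<dots> = mono_pow F \<beta> (A y) * mono_pow C \<beta> (A y)"
    unfolding mono_pow_def fixed_set_def using C_sub by (intro prod.subset_diff) auto
  also have "mono_pow C \<beta> (A y) = prod \<beta> H"
    using y H finite_C by (intro mono_pow_indicator) (auto simp: Y_pattern_def)
  also have "prod \<beta> H = prod \<beta> ((V \<inter> H) \<union> ((C - V) \<inter> H))"
    using H by (intro arg_cong[where f = "prod \<beta>"]) blast
  also have "\<dots> = prod \<beta> (V \<inter> H) * prod \<beta> ((C - V) \<inter> H)"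
    using finite_C H finite_subset[OF H] by (intro prod.union_disjoint) auto
  also have "mono_pow F \<beta> (A y) = mono_pow F \<theta> (A y)"
    unfolding mono_pow_def using eq by (intro prod.cong) auto
  finally show ?thesis by (simp add: mult_ac)
qed

text \<open>Every block meeting H also meets V, since H lies in C. So each entry of \<tau> in H
  outside V is the ratio of its block times the entry of \<theta>, and \<alpha> collects these
  ratios.\<close>

lemma alpha_prod:
  assumes H: "H \<subseteq> C"
  shows "prod \<tau> ((C - V) \<inter> H) = alpha n S V \<theta> t H * prod \<theta> ((C - V) \<inter> H)"
proof -
  let ?I = "{i \<in> {1..n}. S i \<inter> H \<noteq> {}}" and ?B = "\<lambda>i. (S i - V) \<inter> H"
  have fin: "finite H" using H finite_C finite_subset by blast
  have un: "(C - V) \<inter> H = (\<Union>i\<in>?I. ?B i)"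
    using H by (auto simp: covar_set_def)
  have disj: "\<forall>i\<in>?I. \<forall>j\<in>?I. i \<noteq> j \<longrightarrow> ?B i \<inter> ?B j = {}"
    using block_unique by blast
  have blocks: "prod f ((C - V) \<inter> H) = (\<Prod>i\<in>?I. prod f (?B i))" for f :: "nat \<Rightarrow> real"
    unfolding un using fin disj by (intro prod.UNION_disjoint) auto
  have "prod \<tau> (?B i) = (\<Prod>j\<in>?B i. covar_ratio S V \<theta> t i) * prod \<theta> (?B i)" if "i \<in> ?I" for i
  proof -
    have "V \<inter> S i \<noteq> {}" using covar_block_meets_V that H by blast
    then have "prod \<tau> (?B i) = (\<Prod>j\<in>?B i. covar_ratio S V \<theta> t i * \<theta> j)"
      using \<tau>_on_block[of i] that by (intro prod.cong) (auto simp: covar_ratio_def)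
    then show ?thesis by (simp only: prod.distrib)
  qed
  \<comment> \<open>Deleting \<open>prod_constant\<close> keeps the inner products of the constant
    ratios in the shape of \<open>alpha_def\<close> instead of turning them into powers.\<close>
  then show ?thesis
    unfolding blocks alpha_def by (simp add: prod.distrib del: prod_constant)
qed

lemma constr_sum_eq:
  assumes \<beta>: "\<beta> \<in> sensi_params k n S V \<theta> t"
  shows "constr_sum Y k A n S V \<theta> t \<beta> =
    (\<Sum>y\<in>Y. (mono_density Y k A \<beta> y - mono_density Y k A \<tau> y)
      * ln (mono_density Y k A \<tau> y / mono_density Y k A \<theta> y))"
proof -
  let ?g = "\<lambda>y. (mono_density Y k A \<beta> y - mono_density Y k A \<tau> y)
      * ln (mono_density Y k A \<tau> y / mono_density Y k A \<theta> y)"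
  let ?pat = "\<lambda>y. {i \<in> C. A y i = 1}"
  let ?c = "\<lambda>H. prod \<tau> (V \<inter> H) * (prod \<beta> ((C - V) \<inter> H) - prod \<tau> ((C - V) \<inter> H))
        * ln (alpha n S V \<theta> t H * (prod \<tau> (V \<inter> H) / prod \<theta> (V \<inter> H)))
        * (\<Sum>y\<in>Y_pattern Y A C H. mono_pow F \<theta> (A y))"
  have \<tau>F: "\<forall>j\<in>F. \<tau> j = \<theta> j" and \<beta>F: "\<forall>j\<in>F. \<beta> j = \<theta> j"
    and \<beta>V: "\<forall>j\<in>V. \<beta> j = \<tau> j"
    using \<tau>_sensi \<beta> by (auto simp: sensi_params_def)
  \<comment> \<open>Multilinearity makes not being 1 the same as being 0, so the pattern sets are
    the fibres of \<open>?pat\<close>.\<close>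
  have pattern: "Y_pattern Y A C H = {y \<in> Y. ?pat y = H}" if "H \<subseteq> C" for H
  proof -
    have "(\<forall>i\<in>H. A y i = 1) \<and> (\<forall>i\<in>C - H. A y i = 0) \<longleftrightarrow> ?pat y = H" if "y \<in> Y" for y
    proof -
      have "A y j = 0 \<longleftrightarrow> A y j \<noteq> 1" if "j \<in> C" for j
        using multilinear \<open>y \<in> Y\<close> that C_sub unfolding multilinear_model_def by force
      then show ?thesis using \<open>H \<subseteq> C\<close> by blast
    qed
    then show ?thesis unfolding Y_pattern_def by blast
  qed
  have summand: "?g y = prod \<tau> (V \<inter> H) * (prod \<beta> ((C - V) \<inter> H) - prod \<tau> ((C - V) \<inter> H))
        * ln (alpha n S V \<theta> t H * (prod \<tau> (V \<inter> H) / prod \<theta> (V \<inter> H))) * mono_pow F \<theta> (A y)"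
    if H: "H \<subseteq> C" and y: "y \<in> Y_pattern Y A C H" for y H
  proof -
    have m: "mono_pow F \<theta> (A y) > 0"
      using \<theta>_pos by (intro mono_pow_pos) (auto simp: fixed_set_def)
    have p: "prod \<theta> ((C - V) \<inter> H) > 0"
      using \<theta>_pos C_sub by (intro prod_pos) blast
    have "prod \<beta> (V \<inter> H) = prod \<tau> (V \<inter> H)" using \<beta>V by (intro prod.cong) auto
    \<comment> \<open>The F-factor and the product of \<theta> over H outside V cancel; what remains
      depends on H alone. The fact \<open>ballI[OF refl]\<close> is the trivial agreement of
      \<theta> with itself on F.\<close>
    moreover have "mono_density Y k A \<tau> y / mono_density Y k A \<theta> y =
        alpha n S V \<theta> t H * (prod \<tau> (V \<inter> H) / prod \<theta> (V \<inter> H))"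
      unfolding density_on_pattern[OF y H \<tau>F] density_on_pattern[OF y H ballI[OF refl]]
        alpha_prod[OF H] using m p by simp
    ultimately show ?thesis
      unfolding density_on_pattern[OF y H \<beta>F] density_on_pattern[OF y H \<tau>F]
      by (simp only: left_diff_distrib right_diff_distrib mult_ac)
  qed
  have group: "?c H = (\<Sum>y\<in>{y \<in> Y. ?pat y = H}. ?g y)" if H: "H \<subseteq> C" for H
    unfolding pattern[OF H, symmetric] sum_distrib_left
    using summand[OF H] by (intro sum.cong) auto
  have "constr_sum Y k A n S V \<theta> t \<beta> = (\<Sum>H\<in>{H. H \<subseteq> C \<and> H \<noteq> {}}. ?c H)"
    by (simp only: constr_sum_def Let_def)
  \<comment> \<open>The added term H = {} is zero: both products over (C - V) \<inter> H are empty,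
    so their difference is 1 - 1.\<close>
  also have "\<dots> = (\<Sum>H\<in>Pow C. ?c H)"
    using finite_C by (intro sum.mono_neutral_left) auto
  also have "\<dots> = (\<Sum>H\<in>Pow C. \<Sum>y\<in>{y \<in> Y. ?pat y = H}. ?g y)"
    using group by (intro sum.cong) auto
  \<comment> \<open>\<open>?pat\<close> maps Y into the finite set \<open>Pow C\<close>, so its
    fibres partition Y.\<close>
  also have "\<dots> = (\<Sum>y\<in>Y. ?g y)"
    using finite_Y finite_C by (intro sum.group) auto
  finally show ?thesis .
qed

section \<open>The projection property\<close>

lemma prop_covar_I_projection:
  "is_I_projection Y (mono_density Y k A \<theta>) (L_constr Y k A n S V \<theta> t) (mono_density Y k A \<tau>)"
  unfolding is_I_projection_def
proof (intro conjI ballI)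
  \<comment> \<open>For \<beta> = \<tau> every term of the rewritten constraint sum has a zero
    factor, so the constraint holds with equality.\<close>
  show "mono_density Y k A \<tau> \<in> L_constr Y k A n S V \<theta> t"
    unfolding L_constr_def L_sensi_def MM_def
    using \<tau>_sensi \<tau>_param constr_sum_eq[OF \<tau>_sensi] by auto
next
  fix Q assume "Q \<in> L_constr Y k A n S V \<theta> t"
  then obtain \<beta> where \<beta>: "\<beta> \<in> sensi_params k n S V \<theta> t" and Q: "Q = mono_density Y k A \<beta>"
    and constr: "constr_sum Y k A n S V \<theta> t \<beta> \<ge> 0"
    unfolding L_constr_def by blast
  have \<beta>_param: "\<beta> \<in> param_space k n S" using \<beta> by (simp add: sensi_params_def)
  have "I_divergence Y Q (mono_density Y k A \<tau>) \<ge> 0"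
    unfolding Q using finite_Y density_pos density_sum \<beta>_param \<tau>_param
    by (intro I_divergence_nonneg) auto
  moreover have "I_divergence Y Q (mono_density Y k A \<theta>)
        - I_divergence Y (mono_density Y k A \<tau>) (mono_density Y k A \<theta>) =
      I_divergence Y Q (mono_density Y k A \<tau>) + constr_sum Y k A n S V \<theta> t \<beta>"
    unfolding Q constr_sum_eq[OF \<beta>]
    using density_pos \<beta>_param \<tau>_param \<theta> by (intro I_divergence_diff) auto
  ultimately show "I_divergence Y (mono_density Y k A \<tau>) (mono_density Y k A \<theta>)
      \<le> I_divergence Y Q (mono_density Y k A \<theta>)"
    using constr by linarith
qed

end

theorem corollary2:
  fixes Y :: "'y set" and k n :: nat and A :: "'y \<Rightarrow> nat \<Rightarrow> nat"
    and S :: "nat \<Rightarrow> nat set" and V :: "nat set" and \<theta> t :: "nat \<Rightarrow> real"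
  assumes "monomial_model Y k A n S"
    and "multilinear_model Y k A"
    and "regular_model Y A n S"
    and "\<theta> \<in> param_space k n S"
    and "V \<noteq> {}" and "V \<subset> {1..k}"
    and "\<forall>i\<in>{1..n}. V \<inter> S i \<subset> S i"
    and "\<forall>j\<in>V. t j > 0"
    and "\<forall>i\<in>{1..n}. V \<inter> S i \<noteq> {} \<longrightarrow> (\<Sum>j\<in>V \<inter> S i. t j) \<in> {0<..<1}"
  shows "is_I_projection Y (mono_density Y k A \<theta>) (L_constr Y k A n S V \<theta> t)
           (mono_density Y k A (prop_covar n S V \<theta> t))"
proof -
  interpret covariation Y k n A S V \<theta> t
    using assms by unfold_locales auto
  show ?thesis by (rule prop_covar_I_projection)
qed

end
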